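(* Let $\mathbb K$ be a field of characteristic zero and let $\mathcal G=\mathfrak B\ltimes\mathbb K^n$ be a 2-step solvable Frobenius Lie algebra over $\mathbb K$, where $\mathbb K^n=[\mathcal G,\mathcal G]$ is the derived ideal and $\mathfrak B$ is a complementary subspace of $\mathbb K^n$ in $\mathcal G$ which is an Abelian subalgebra. Let $\alpha$ be a Frobenius functional on $\mathcal G$, chosen in $(\mathbb K^n)^*$ (that is, vanishing on $\mathfrak B$), let $\omega=\partial\alpha$, and let $\star$ be the left symmetric product induced on $\mathcal G$ by $\omega$. Then $\star$ preserves $\mathfrak B$: $a\star b\in\mathfrak B$ for all $a,b\in\mathfrak B$. Furthermore, suppose $\mathfrak B$ is chosen to be an $n$-dimensional subspace of commuting $n\times n$ matrices with entries in $\mathbb K$, acting on $\mathbb K^n$ by $[a,x]=ax$ (matrix times vector). Denote by $ab$ the ordinary product of matrices. Then $\star$ is completely characterized, for all $a,b\in\mathfrak B$ and $x,y\in\mathbb K^n$, by $$a\star b=-ab,\qquad a\star x=0,\qquad x\star y=0,\qquad x\star a=-ax .$$ In particular the product $ab$ of two matrices $a,b\in\mathfrak B$ lies again in $\mathfrak B$. The principal element $v_0$ corresponding to $\alpha$ equals $-\mathbb I_{\mathbb K^n}$, where $\mathbb I_{\mathbb K^n}$ is the $n\times n$ identity matrix.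
   Context: All Lie algebras are finite dimensional. A Lie algebra $\mathcal G$ is 2-step solvable if $[\mathcal G,\mathcal G]$ is Abelian. It is Frobenius if there is $\alpha\in\mathcal G^*$ (a Frobenius functional) such that the skew-symmetric form $\omega=\partial\alpha$, $\partial\alpha(u,v):=-\alpha([u,v])$, is nondegenerate. The semidirect sum $\mathfrak B\ltimes\mathbb K^n$ has underlying space $\mathfrak B\oplus\mathbb K^n$, with $[a,b]=[x,y]=0$ for $a,b\in\mathfrak B$, $x,y\in\mathbb K^n$, and $[a,x]$ given by a linear action of $\mathfrak B$ on $\mathbb K^n$. Elements of $(\mathbb K^n)^*$ are viewed as linear forms on $\mathcal G$ vanishing on $\mathfrak B$. The product $\star$ induced by $\omega$ is defined by $\omega(u\star v,w):=-\omega(v,[u,w])$ for all $u,v,w\in\mathcal G$; it is a left symmetric algebra structure (its associator is symmetric in the first two arguments) satisfying $u\star v-v\star u=[u,v]$. The principal element corresponding to $\alpha$ is the unique $v_0\in\mathcal G$ with $\omega(v_0,\cdot)=\alpha$. *)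

theory Defs
  imports "HOL-Analysis.Analysis"
begin

text \<open>
  A finite-dimensional Lie algebra over a field. The carrier \<open>G\<close> is a subspace of an ambient vector
  space, so that a Lie algebra such as the semidirect sum of a subspace of matrices and a space of
  vectors can be used without introducing a new type. Nothing is assumed about \<open>br\<close> outside \<open>G\<close>.
\<close>

locale lie_algebra = vector_space sc
  for sc :: "'k::field \<Rightarrow> 'g::ab_group_add \<Rightarrow> 'g" +
  fixes G :: "'g set" and br :: "'g \<Rightarrow> 'g \<Rightarrow> 'g"
  assumes finite_dimensional: "\<exists>S. finite S \<and> G = span S"
    and br_closed: "u \<in> G \<Longrightarrow> v \<in> G \<Longrightarrow> br u v \<in> G"
    and br_add_left: "u \<in> G \<Longrightarrow> v \<in> G \<Longrightarrow> w \<in> G \<Longrightarrow> br (u + v) w = br u w + br v w"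
    and br_add_right: "u \<in> G \<Longrightarrow> v \<in> G \<Longrightarrow> w \<in> G \<Longrightarrow> br u (v + w) = br u v + br u w"
    and br_scale_left: "u \<in> G \<Longrightarrow> v \<in> G \<Longrightarrow> br (sc c u) v = sc c (br u v)"
    and br_scale_right: "u \<in> G \<Longrightarrow> v \<in> G \<Longrightarrow> br u (sc c v) = sc c (br u v)"
    and br_self: "u \<in> G \<Longrightarrow> br u u = 0"
    and jacobi: "u \<in> G \<Longrightarrow> v \<in> G \<Longrightarrow> w \<in> G \<Longrightarrow>
      br u (br v w) + br v (br w u) + br w (br u v) = 0"

definition derived_ideal ::
    "('k::field \<Rightarrow> 'g::ab_group_add \<Rightarrow> 'g) \<Rightarrow> 'g set \<Rightarrow> ('g \<Rightarrow> 'g \<Rightarrow> 'g) \<Rightarrow> 'g set" where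
  "derived_ideal sc G br = module.span sc {br u v | u v. u \<in> G \<and> v \<in> G}"

definition abelian_on :: "('g::zero \<Rightarrow> 'g \<Rightarrow> 'g) \<Rightarrow> 'g set \<Rightarrow> bool" where
  "abelian_on br A \<longleftrightarrow> (\<forall>u\<in>A. \<forall>v\<in>A. br u v = 0)"

definition two_step_solvable ::
    "('k::field \<Rightarrow> 'g::ab_group_add \<Rightarrow> 'g) \<Rightarrow> 'g set \<Rightarrow> ('g \<Rightarrow> 'g \<Rightarrow> 'g) \<Rightarrow> bool" where
  "two_step_solvable sc G br \<longleftrightarrow> abelian_on br (derived_ideal sc G br)"

definition linear_form_on ::
    "('k::field \<Rightarrow> 'g::ab_group_add \<Rightarrow> 'g) \<Rightarrow> 'g set \<Rightarrow> ('g \<Rightarrow> 'k) \<Rightarrow> bool" where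
  "linear_form_on sc G \<alpha> \<longleftrightarrow>
     (\<forall>u\<in>G. \<forall>v\<in>G. \<alpha> (u + v) = \<alpha> u + \<alpha> v) \<and> (\<forall>c. \<forall>u\<in>G. \<alpha> (sc c u) = c * \<alpha> u)"

definition coboundary :: "('g \<Rightarrow> 'g \<Rightarrow> 'g) \<Rightarrow> ('g \<Rightarrow> 'k::field) \<Rightarrow> 'g \<Rightarrow> 'g \<Rightarrow> 'k" where
  "coboundary br \<alpha> u v = - \<alpha> (br u v)"

text \<open>
  Nondegeneracy is only ever used for skew-symmetric forms, for which the left and right radicals
  coincide.
\<close>

definition nondegenerate_on :: "'g::zero set \<Rightarrow> ('g \<Rightarrow> 'g \<Rightarrow> 'k::field) \<Rightarrow> bool" where
  "nondegenerate_on G \<omega> \<longleftrightarrow> (\<forall>u\<in>G. (\<forall>v\<in>G. \<omega> u v = 0) \<longrightarrow> u = 0)"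

definition frobenius_functional ::
    "('k::field \<Rightarrow> 'g::ab_group_add \<Rightarrow> 'g) \<Rightarrow> 'g set \<Rightarrow> ('g \<Rightarrow> 'g \<Rightarrow> 'g) \<Rightarrow> ('g \<Rightarrow> 'k) \<Rightarrow> bool" where
  "frobenius_functional sc G br \<alpha> \<longleftrightarrow>
     linear_form_on sc G \<alpha> \<and> nondegenerate_on G (coboundary br \<alpha>)"

text \<open>
  If \<open>\<omega>\<close> is a nondegenerate bilinear form on the finite-dimensional space \<open>G\<close>, the descriptions below
  determine a unique element of \<open>G\<close>.
\<close>

definition induced_product ::
    "'g set \<Rightarrow> ('g \<Rightarrow> 'g \<Rightarrow> 'g) \<Rightarrow> ('g \<Rightarrow> 'g \<Rightarrow> 'k::field) \<Rightarrow> 'g \<Rightarrow> 'g \<Rightarrow> 'g" where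
  "induced_product G br \<omega> u v = (THE z. z \<in> G \<and> (\<forall>w\<in>G. \<omega> z w = - \<omega> v (br u w)))"

definition principal_element ::
    "'g set \<Rightarrow> ('g \<Rightarrow> 'g \<Rightarrow> 'g) \<Rightarrow> ('g \<Rightarrow> 'k::field) \<Rightarrow> 'g" where
  "principal_element G br \<alpha> = (THE z. z \<in> G \<and> (\<forall>w\<in>G. coboundary br \<alpha> z w = \<alpha> w))"

definition bilinear_product_on ::
    "('k::field \<Rightarrow> 'g::ab_group_add \<Rightarrow> 'g) \<Rightarrow> 'g set \<Rightarrow> ('g \<Rightarrow> 'g \<Rightarrow> 'g) \<Rightarrow> bool" where
  "bilinear_product_on sc G p \<longleftrightarrow>
     (\<forall>u\<in>G. \<forall>v\<in>G. p u v \<in> G) \<and>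
     (\<forall>u\<in>G. \<forall>v\<in>G. \<forall>w\<in>G. p (u + v) w = p u w + p v w \<and> p u (v + w) = p u v + p u w) \<and>
     (\<forall>c. \<forall>u\<in>G. \<forall>v\<in>G. p (sc c u) v = sc c (p u v) \<and> p u (sc c v) = sc c (p u v))"

text \<open>
  The standing assumptions: \<open>G\<close> is two-step solvable, \<open>B\<close> is an Abelian subalgebra which is a vector
  space complement of the derived ideal, and \<open>\<alpha>\<close> is a Frobenius functional on \<open>G\<close> vanishing on \<open>B\<close>.
  Since the derived ideal is Abelian as well, this says that \<open>G\<close> is the (internal) semidirect sum
  of \<open>B\<close> and its derived ideal, \<open>B\<close> acting by the bracket.
\<close>

locale two_step_frobenius = lie_algebra sc G br
  for sc :: "'k::field \<Rightarrow> 'g::ab_group_add \<Rightarrow> 'g" and G br +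
  fixes B :: "'g set" and \<alpha> :: "'g \<Rightarrow> 'k"
  assumes two_step: "two_step_solvable sc G br"
    and B_subspace: "subspace B"
    and B_disjoint: "B \<inter> derived_ideal sc G br = {0}"
    and B_complement: "G = {b + d | b d. b \<in> B \<and> d \<in> derived_ideal sc G br}"
    and B_abelian: "abelian_on br B"
    and frobenius: "frobenius_functional sc G br \<alpha>"
    and \<alpha>_vanishes: "b \<in> B \<Longrightarrow> \<alpha> b = 0"

text \<open>The external semidirect sum of square matrices and column vectors, with matrices acting by
  \<open>[a, x] = a x\<close>.\<close>

definition matrix_scale :: "'k::field \<Rightarrow> 'k^'n^'n \<Rightarrow> 'k^'n^'n" where
  "matrix_scale c a = (\<chi> i j. c * a $ i $ j)"

definition semidirect_scale ::
    "'k::field \<Rightarrow> (('k^'n^'n) \<times> ('k^'n)) \<Rightarrow> (('k^'n^'n) \<times> ('k^'n))" where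
  "semidirect_scale = module_prod.scale matrix_scale (*s)"

definition semidirect_bracket ::
    "(('k::field^'n^'n) \<times> ('k^'n)) \<Rightarrow> (('k^'n^'n) \<times> ('k^'n)) \<Rightarrow> (('k^'n^'n) \<times> ('k^'n))" where
  "semidirect_bracket u v = (0, fst u *v snd v - fst v *v snd u)"

end

theory Submission
  imports Defs
begin

text \<open>
  Write \<open>D\<close> for the derived ideal. Since \<open>B\<close> and \<open>D\<close> are Abelian, both are isotropic for \<open>\<omega>\<close>, so an
  element of \<open>D\<close> orthogonal to \<open>B\<close> vanishes; as \<open>\<omega> (a \<star> b) c = \<alpha> [b, [a, c]] = 0\<close> for \<open>c\<close> in \<open>B\<close>, the
  component of \<open>a \<star> b\<close> in \<open>D\<close> vanishes. For matrices this means \<open>a \<star> b = (c, 0)\<close> with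
  \<open>\<beta> ((c + a b) x) = 0\<close> for all \<open>x\<close>. Replacing \<open>x\<close> by \<open>d x\<close> with \<open>d\<close> in \<open>M\<close> and commuting \<open>d\<close> to the
  left, nondegeneracy turns this into \<open>c = - a b\<close>. The same argument identifies the principal element.
\<close>

section \<open>Matrix identities and induction over a span\<close>

lemma matrix_add_rdistrib: "(A + B) ** C = A ** C + B ** C"
  for A B :: "'k::semiring_1^'n^'m"
  by (vector matrix_matrix_mult_def sum.distrib[symmetric] distrib_right)

lemma matrix_vector_mult_minus: "A *v (- x) = - (A *v x)"
  for A :: "'k::ring_1^'n^'m"
  by (vector matrix_vector_mult_def sum_negf)

text \<open>The step case records that \<open>y\<close> lies in the span. This is indispensable for
  forms and brackets whose laws are assumed only on a carrier \<open>G\<close>.\<close>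

lemma (in module) span_induct_closed [consumes 1, case_names base step]:
  assumes x: "x \<in> span S"
    and base: "P 0"
    and step: "\<And>c x y. x \<in> S \<Longrightarrow> y \<in> span S \<Longrightarrow> P y \<Longrightarrow> P (scale c x + y)"
  shows "P x"
proof -
  have "x \<in> span S \<and> P x"
    using x
    by (induction rule: span_induct_alt) (auto intro: base step span_zero span_add span_scale span_base)
  then show ?thesis by simp
qed

section \<open>Representing linear forms by a nondegenerate bilinear form\<close>

text \<open>For a basis \<open>E\<close> of \<open>G\<close>, the map sending \<open>u\<close> to
  the combination of \<open>E\<close> with coefficients \<open>\<omega> u e\<close> is injective by
  nondegeneracy, hence onto \<open>G\<close> by counting dimensions. A preimage of the combination
  with coefficients \<open>f e\<close> represents \<open>f\<close>.\<close>

lemma (in vector_space) nondegenerate_form_represents: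
  fixes \<omega> :: "'b \<Rightarrow> 'b \<Rightarrow> 'a"
  assumes fin: "finite S" "G = span S"
    and add_left: "\<And>u v w. u \<in> G \<Longrightarrow> v \<in> G \<Longrightarrow> w \<in> G \<Longrightarrow> \<omega> (u + v) w = \<omega> u w + \<omega> v w"
    and scale_left: "\<And>c u w. u \<in> G \<Longrightarrow> w \<in> G \<Longrightarrow> \<omega> (scale c u) w = c * \<omega> u w"
    and lin_right: "\<And>u. u \<in> G \<Longrightarrow> linear_form_on scale G (\<omega> u)"
    and nondeg: "nondegenerate_on G \<omega>"
    and f: "linear_form_on scale G f"
  shows "\<exists>z\<in>G. \<forall>w\<in>G. \<omega> z w = f w"
proof -
  interpret pair: vector_space_pair scale scale ..
  obtain E where E: "E \<subseteq> S" "independent E" "span E = G"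
    using maximal_independent_subset[of S] fin(2) by (metis span_mono span_span subset_antisym)
  have finE: "finite E" using E(1) fin(1) finite_subset by blast
  have EG: "E \<subseteq> G" using E(3) span_superset by blast
  have G0: "0 \<in> G" using E(3) span_zero by blast
  \<comment> \<open>The forms are linear on \<open>G\<close> only, possibly not on the whole type,
    so their determination by values on a basis is proved by induction over the span.\<close>
  have form_eq: "g w = h w"
    if "linear_form_on scale G g" "linear_form_on scale G h" "\<And>e. e \<in> E \<Longrightarrow> g e = h e" "w \<in> G" for g h w
  proof -
    have split: "k (scale c x + y) = c * k x + k y"
      if "linear_form_on scale G k" "x \<in> G" "y \<in> G" "scale c x \<in> G" for k c x y
      using that unfolding linear_form_on_def by simp
    have zero: "k 0 = 0" if "linear_form_on scale G k" for k :: "'b \<Rightarrow> 'a"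
      using that G0 unfolding linear_form_on_def by (metis mult_zero_left scale_zero_left)
    have "w \<in> span E" using that(4) E(3) by simp
    then show ?thesis
    proof (induction rule: span_induct_closed)
      case base
      show ?case using zero[OF that(1)] zero[OF that(2)] by simp
    next
      case (step c x y)
      have "x \<in> G" "y \<in> G" "scale c x \<in> G"
        using step(1,2) by (auto simp: E(3)[symmetric] span_base span_scale)
      then show ?case
        using step that(3) by (simp add: split[OF that(1)] split[OF that(2)])
    qed
  qed
  \<comment> \<open>Off \<open>G\<close> the coefficients \<open>\<omega> u e\<close> are
    unconstrained, so the formula itself need not define a linear map. Extending its values on
    \<open>E\<close> linearly gives a map that is linear everywhere and agrees with the formula on
    \<open>G\<close>.\<close>
  define \<phi> where "\<phi> = pair.construct E (\<lambda>u. \<Sum>e\<in>E. scale (\<omega> u e) e)"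
  have lin: "Vector_Spaces.linear scale scale \<phi>"
    unfolding \<phi>_def by (rule pair.linear_construct[OF E(2)])
  interpret \<phi>: Vector_Spaces.linear scale scale \<phi> by (rule lin)
  have \<phi>: "\<phi> u = (\<Sum>e\<in>E. scale (\<omega> u e) e)" if "u \<in> G" for u
  proof -
    have "u \<in> span E" using that E(3) by simp
    then show ?thesis
    proof (induction rule: span_induct_closed)
      case base
      have "\<omega> 0 e = 0" if "e \<in> E" for e
        using scale_left[of 0 e 0] that EG G0 by auto
      then show ?case using \<phi>.zero by simp
    next
      case (step c x y)
      have G: "x \<in> G" "y \<in> G" "scale c x \<in> G"
        using step(1,2) by (auto simp: E(3)[symmetric] span_base span_scale)
      have "\<phi> x = (\<Sum>e\<in>E. scale (\<omega> x e) e)"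
        unfolding \<phi>_def by (rule pair.construct_basis[OF E(2) step(1)])
      then have "\<phi> (scale c x + y) = (\<Sum>e\<in>E. scale (c * \<omega> x e + \<omega> y e) e)"
        using step by (simp add: \<phi>.add \<phi>.scale scale_sum_right scale_left_distrib sum.distrib)
      also have "\<dots> = (\<Sum>e\<in>E. scale (\<omega> (scale c x + y) e) e)"
        by (rule sum.cong) (use G EG in \<open>auto simp: add_left scale_left subset_iff\<close>)
      finally show ?case .
    qed
  qed
  have coeffs: "g e = h e" if "(\<Sum>e\<in>E. scale (g e) e) = (\<Sum>e\<in>E. scale (h e) e)" "e \<in> E" for g h e
  proof -
    have "(\<Sum>e\<in>E. scale (g e - h e) e) = 0"
      using that(1) by (simp add: scale_left_diff_distrib sum_subtractf)
    from independentD[OF E(2) finE subset_refl this that(2)] show ?thesis by simp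
  qed
  \<comment> \<open>An element of the kernel is orthogonal to every basis vector, hence to all of
    \<open>G\<close>, so it lies in the radical.\<close>
  have "inj_on \<phi> (span E)"
  proof (rule \<phi>.inj_on_iff_eq_0[THEN iffD2, OF subspace_span], intro ballI impI)
    fix u assume u: "u \<in> span E" "\<phi> u = 0"
    then have uG: "u \<in> G" using E(3) by simp
    have "\<omega> u e = 0" if "e \<in> E" for e
      using coeffs[of "\<omega> u" "\<lambda>_. 0" e] \<phi>[OF uG] u(2) that by simp
    then have "\<omega> u w = 0" if "w \<in> G" for w
      using form_eq[OF lin_right[OF uG], of "\<lambda>_. 0"] that by (simp add: linear_form_on_def)
    then show "u = 0" using nondeg uG unfolding nondegenerate_on_def by blast
  qed
  then have ind: "independent (\<phi> ` E)" and inj: "inj_on \<phi> E"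
    using \<phi>.independent_injective_image[OF E(2)] inj_on_subset span_superset by blast+
  have in_span: "(\<Sum>e\<in>E. scale (g e) e) \<in> span E" for g
    by (intro span_sum span_scale span_base)
  then have sub: "\<phi> ` E \<subseteq> span E"
    by (auto simp: \<phi> subsetD[OF EG])
  have "span E \<subseteq> span (\<phi> ` E)"
  proof (rule ccontr)
    assume "\<not> span E \<subseteq> span (\<phi> ` E)"
    then obtain y where y: "y \<in> span E" "y \<notin> span (\<phi> ` E)" by blast
    then have "independent (insert y (\<phi> ` E))"
      using ind independent_insert span_base by auto
    then have "card (insert y (\<phi> ` E)) \<le> card E"
      using independent_span_bound[OF finE] sub y(1) by blast
    moreover have "card (insert y (\<phi> ` E)) = Suc (card E)"
      using y(2) finE inj by (subst card_insert_disjoint) (auto simp: card_image span_base)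
    ultimately show False by simp
  qed
  then have "(\<Sum>e\<in>E. scale (f e) e) \<in> \<phi> ` span E"
    unfolding \<phi>.span_image[symmetric] by (rule subsetD) (rule in_span)
  then obtain z where z: "z \<in> G" "\<phi> z = (\<Sum>e\<in>E. scale (f e) e)"
    using E(3) by force
  then have "\<omega> z e = f e" if "e \<in> E" for e
    using coeffs[of "\<omega> z" f e] \<phi>[OF z(1)] that by simp
  then show ?thesis
    using form_eq[OF lin_right[OF z(1)] f] z(1) by blast
qed

section \<open>The induced product and the principal element of a Frobenius Lie algebra\<close>

locale frobenius_lie_algebra = lie_algebra sc G br
  for sc :: "'k::field \<Rightarrow> 'g::ab_group_add \<Rightarrow> 'g" and G br +
  fixes \<alpha> :: "'g \<Rightarrow> 'k"
  assumes frobenius_\<alpha>: "frobenius_functional sc G br \<alpha>"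
begin

abbreviation \<omega> :: "'g \<Rightarrow> 'g \<Rightarrow> 'k" where "\<omega> \<equiv> coboundary br \<alpha>"

abbreviation star :: "'g \<Rightarrow> 'g \<Rightarrow> 'g" where "star \<equiv> induced_product G br \<omega>"

lemma subspace_G: "subspace G"
  using finite_dimensional subspace_span by auto

lemmas G_closed = subspace_0[OF subspace_G] subspace_add[OF subspace_G] subspace_scale[OF subspace_G]
  subspace_diff[OF subspace_G] subspace_neg[OF subspace_G] br_closed

lemma \<alpha>_add: "u \<in> G \<Longrightarrow> v \<in> G \<Longrightarrow> \<alpha> (u + v) = \<alpha> u + \<alpha> v"
  and \<alpha>_scale: "u \<in> G \<Longrightarrow> \<alpha> (sc c u) = c * \<alpha> u"
  using frobenius_\<alpha> unfolding frobenius_functional_def linear_form_on_def by auto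

lemma \<alpha>_zero: "\<alpha> 0 = 0"
  using \<alpha>_scale[of 0 0] G_closed(1) by simp

lemma \<omega>_add_left: "u \<in> G \<Longrightarrow> v \<in> G \<Longrightarrow> w \<in> G \<Longrightarrow> \<omega> (u + v) w = \<omega> u w + \<omega> v w"
  and \<omega>_add_right: "u \<in> G \<Longrightarrow> v \<in> G \<Longrightarrow> w \<in> G \<Longrightarrow> \<omega> u (v + w) = \<omega> u v + \<omega> u w"
  and \<omega>_scale_left: "u \<in> G \<Longrightarrow> w \<in> G \<Longrightarrow> \<omega> (sc c u) w = c * \<omega> u w"
  and \<omega>_scale_right: "u \<in> G \<Longrightarrow> w \<in> G \<Longrightarrow> \<omega> u (sc c w) = c * \<omega> u w"
  by (simp_all add: coboundary_def br_add_left br_add_right br_scale_left br_scale_right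
      \<alpha>_add \<alpha>_scale br_closed)

lemma \<omega>_nondegenerate: "u \<in> G \<Longrightarrow> (\<And>w. w \<in> G \<Longrightarrow> \<omega> u w = 0) \<Longrightarrow> u = 0"
  using frobenius_\<alpha> unfolding frobenius_functional_def nondegenerate_on_def by blast

lemma \<omega>_cancel:
  assumes "u \<in> G" "v \<in> G" and eq: "\<And>w. w \<in> G \<Longrightarrow> \<omega> u w = \<omega> v w"
  shows "u = v"
proof -
  have "\<omega> (u - v) w = 0" if "w \<in> G" for w
    using \<omega>_add_left[of "u - v" v w] assms that G_closed by simp
  then show ?thesis using \<omega>_nondegenerate[of "u - v"] assms G_closed by simp
qed

lemma \<omega>_represents:
  assumes "linear_form_on sc G f"
  shows "\<exists>z\<in>G. \<forall>w\<in>G. \<omega> z w = f w"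
proof -
  obtain S where "finite S" "G = span S" using finite_dimensional by blast
  then show ?thesis
    by (rule nondegenerate_form_represents)
      (use assms frobenius_\<alpha> in \<open>auto simp: \<omega>_add_left \<omega>_scale_left \<omega>_add_right \<omega>_scale_right
        linear_form_on_def frobenius_functional_def\<close>)
qed

text \<open>Representability of the form \<open>- \<omega> v (br u w)\<close> in \<open>w\<close>
  gives existence and \<open>\<omega>_cancel\<close> gives uniqueness, so the definite description
  in \<open>induced_product\<close> denotes.\<close>

lemma
  assumes "u \<in> G" "v \<in> G"
  shows star_closed: "star u v \<in> G"
    and \<omega>_star: "w \<in> G \<Longrightarrow> \<omega> (star u v) w = - \<omega> v (br u w)"
proof -
  have "linear_form_on sc G (\<lambda>w. - \<omega> v (br u w))"
    using assms by (simp add: linear_form_on_def br_add_right br_scale_right \<omega>_add_right \<omega>_scale_right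
        G_closed)
  from \<omega>_represents[OF this] obtain z where z: "z \<in> G \<and> (\<forall>w\<in>G. \<omega> z w = - \<omega> v (br u w))" by blast
  then have "star u v \<in> G \<and> (\<forall>w\<in>G. \<omega> (star u v) w = - \<omega> v (br u w))"
    unfolding induced_product_def by (rule theI) (use z in \<open>auto intro: \<omega>_cancel\<close>)
  then show "star u v \<in> G" "w \<in> G \<Longrightarrow> \<omega> (star u v) w = - \<omega> v (br u w)" by auto
qed

text \<open>Reduces every later evaluation of the product to guessing the value and pairing it with
  all \<open>w\<close>.\<close>

lemma star_eqI:
  assumes "u \<in> G" "v \<in> G" "z \<in> G" "\<And>w. w \<in> G \<Longrightarrow> \<omega> z w = - \<omega> v (br u w)"
  shows "star u v = z"
  using assms by (intro \<omega>_cancel) (auto simp: star_closed \<omega>_star)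

lemma bilinear_star: "bilinear_product_on sc G star"
proof -
  have "star (u + v) w = star u w + star v w" "star u (v + w) = star u v + star u w"
    if "u \<in> G" "v \<in> G" "w \<in> G" for u v w
    by (rule star_eqI; simp add: that star_closed G_closed \<omega>_star br_add_left \<omega>_add_left \<omega>_add_right)+
  moreover have "star (sc c u) v = sc c (star u v)" "star u (sc c v) = sc c (star u v)"
    if "u \<in> G" "v \<in> G" for c u v
    by (rule star_eqI; simp add: that star_closed G_closed \<omega>_star br_scale_left \<omega>_scale_left
        \<omega>_scale_right)+
  ultimately show ?thesis
    unfolding bilinear_product_on_def by (simp add: star_closed)
qed

lemma
  shows principal_element_closed: "principal_element G br \<alpha> \<in> G"
    and \<omega>_principal_element: "w \<in> G \<Longrightarrow> \<omega> (principal_element G br \<alpha>) w = \<alpha> w"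
proof -
  have "linear_form_on sc G \<alpha>"
    using frobenius_\<alpha> unfolding frobenius_functional_def by blast
  from \<omega>_represents[OF this] obtain z where z: "z \<in> G \<and> (\<forall>w\<in>G. \<omega> z w = \<alpha> w)" by blast
  then have "principal_element G br \<alpha> \<in> G \<and> (\<forall>w\<in>G. \<omega> (principal_element G br \<alpha>) w = \<alpha> w)"
    unfolding principal_element_def by (rule theI) (use z in \<open>auto intro: \<omega>_cancel\<close>)
  then show "principal_element G br \<alpha> \<in> G" "w \<in> G \<Longrightarrow> \<omega> (principal_element G br \<alpha>) w = \<alpha> w" by auto
qed

end

section \<open>The complement \<open>B\<close> as a Lagrangian subspace\<close>

sublocale two_step_frobenius \<subseteq> frobenius_lie_algebra
  by unfold_locales (rule frobenius)

context two_step_frobenius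
begin

abbreviation D :: "'g set" where "D \<equiv> derived_ideal sc G br"

lemma subspace_D: "subspace D"
  unfolding derived_ideal_def by (rule subspace_span)

lemma B_subset_G: "B \<subseteq> G"
  using B_complement subspace_0[OF subspace_D] by force

lemma D_subset_G: "D \<subseteq> G"
  using B_complement subspace_0[OF B_subspace] by force

lemma \<omega>_B: "b \<in> B \<Longrightarrow> c \<in> B \<Longrightarrow> \<omega> b c = 0"
  using B_abelian by (simp add: abelian_on_def coboundary_def \<alpha>_zero)

lemma \<omega>_D: "x \<in> D \<Longrightarrow> y \<in> D \<Longrightarrow> \<omega> x y = 0"
  using two_step by (simp add: two_step_solvable_def abelian_on_def coboundary_def \<alpha>_zero)

text \<open>The component of \<open>z\<close> in \<open>D\<close> is orthogonal to \<open>B\<close>,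
  because \<open>z\<close> is and \<open>B\<close> is isotropic. It is orthogonal to
  \<open>D\<close>, because \<open>D\<close> is isotropic. Thus it lies in the radical and
  vanishes.\<close>

lemma orthogonal_to_B:
  assumes "z \<in> G" "\<And>c. c \<in> B \<Longrightarrow> \<omega> z c = 0"
  shows "z \<in> B"
proof -
  obtain b x where z: "z = b + x" "b \<in> B" "x \<in> D" using assms(1) B_complement by blast
  then have G: "b \<in> G" "x \<in> G" using B_subset_G D_subset_G by auto
  have xB: "\<omega> x c = 0" if "c \<in> B" for c
    using assms(2)[OF that] \<omega>_add_left[OF G, of c] \<omega>_B[OF z(2) that] z(1) that B_subset_G by auto
  have "\<omega> x w = 0" if "w \<in> G" for w
  proof -
    obtain c y where "w = c + y" "c \<in> B" "y \<in> D" using \<open>w \<in> G\<close> B_complement by blast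
    then show ?thesis
      using \<omega>_add_right[OF G(2), of c y] xB \<omega>_D[OF z(3)] B_subset_G D_subset_G by auto
  qed
  then have "x = 0" by (rule \<omega>_nondegenerate[OF G(2)])
  then show ?thesis using z by simp
qed

lemma star_B_closed:
  assumes "a \<in> B" "b \<in> B"
  shows "star a b \<in> B"
proof (rule orthogonal_to_B)
  have G: "a \<in> G" "b \<in> G" using assms B_subset_G by auto
  then show "star a b \<in> G" by (rule star_closed)
  fix c assume "c \<in> B"
  moreover from this have "br a c = 0" using assms(1) B_abelian by (auto simp: abelian_on_def)
  moreover have "\<omega> b 0 = 0" using \<omega>_B[OF assms(2) subspace_0[OF B_subspace]] .
  ultimately show "\<omega> (star a b) c = 0" using \<omega>_star[OF G] B_subset_G by auto
qed

text \<open>Pairing with \<open>c\<close> in \<open>B\<close> gives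
  \<open>\<alpha> c = 0\<close>.\<close>

lemma principal_element_in_B: "principal_element G br \<alpha> \<in> B"
  using principal_element_closed \<omega>_principal_element B_subset_G \<alpha>_vanishes
  by (intro orthogonal_to_B) auto

end

section \<open>Commuting matrices acting on column vectors\<close>

locale two_step_frobenius_matrices =
  two_step_frobenius semidirect_scale "M \<times> UNIV" semidirect_bracket "M \<times> {0}" \<beta>
  for M :: "('k::field^'n^'n) set" and \<beta> +
  assumes commute: "a \<in> M \<Longrightarrow> b \<in> M \<Longrightarrow> a ** b = b ** a"
begin

lemma zero_in_M: "0 \<in> M"
  using subspace_0[OF B_subspace] by (auto simp: zero_prod_def)

lemma uminus_in_M: "a \<in> M \<Longrightarrow> - a \<in> M"
  using subspace_neg[OF B_subspace, of "(a, 0)"] by auto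

lemma \<omega>_eq: "\<omega> (a, x) (b, y) = - \<beta> (0, a *v y - b *v x)"
  by (simp add: coboundary_def semidirect_bracket_def)

lemma \<beta>_vector_add: "\<beta> (0, x + y) = \<beta> (0, x) + \<beta> (0, y)"
  using \<alpha>_add[of "(0, x)" "(0, y)"] zero_in_M by simp

lemma \<beta>_vector_zero: "\<beta> (0, 0) = 0"
  using \<alpha>_zero by (simp add: zero_prod_def)

lemma \<beta>_vector_minus: "\<beta> (0, - x) = - \<beta> (0, x)"
  using \<beta>_vector_add[of x "- x"] \<beta>_vector_zero by (simp add: eq_neg_iff_add_eq_0 add.commute)

text \<open>Evaluating \<open>\<beta> \<circ> c\<close> at \<open>d x\<close> and using \<open>c d = d c\<close> shows that \<open>c x\<close> is orthogonal to \<open>M\<close>.\<close>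

lemma commuting_matrix_eq_zero:
  assumes "\<And>d. d \<in> M \<Longrightarrow> c ** d = d ** c" "\<And>x. \<beta> (0, c *v x) = 0"
  shows "c = 0"
proof -
  have "c *v x = 0" for x
  proof -
    have "\<omega> (0, c *v x) w = 0" if "w \<in> M \<times> UNIV" for w
    proof -
      obtain d y where w: "w = (d, y)" "d \<in> M" using \<open>w \<in> M \<times> UNIV\<close> by auto
      have "d *v (c *v x) = c *v (d *v x)"
        using assms(1)[OF w(2)] by (simp add: matrix_vector_mul_assoc)
      then show ?thesis using assms(2) by (simp add: w \<omega>_eq \<beta>_vector_minus)
    qed
    then have "(0 :: 'k^'n^'n, c *v x) = 0"
      using zero_in_M by (intro \<omega>_nondegenerate) auto
    then show ?thesis by (simp add: zero_prod_def)
  qed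
  then show ?thesis by (simp add: matrix_eq)
qed

lemma star_matrix_matrix:
  assumes "a \<in> M" "b \<in> M"
  shows "star (a, 0) (b, 0) = (- (a ** b), 0)"
proof -
  obtain c where c: "star (a, 0) (b, 0) = (c, 0)" "c \<in> M"
    using star_B_closed[of "(a, 0)" "(b, 0)"] assms by auto
  \<comment> \<open>Only commutation with \<open>M\<close> is required of this matrix, not
    membership in \<open>M\<close>. That \<open>a ** b\<close> belongs to \<open>M\<close> is
    deduced afterwards from this very identity.\<close>
  have "c + a ** b = 0"
  proof (rule commuting_matrix_eq_zero)
    fix d assume d: "d \<in> M"
    have "(a ** b) ** d = d ** (a ** b)"
      by (metis matrix_mul_assoc commute assms d)
    then show "(c + a ** b) ** d = d ** (c + a ** b)"
      using commute[OF c(2) d] by (simp add: matrix_add_ldistrib matrix_add_rdistrib)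
  next
    fix x
    \<comment> \<open>The defining equation of the product, tested on a vector: it reads
      \<open>\<beta> (0, c *v x) = - \<beta> (0, b *v (a *v x))\<close> up to sign.\<close>
    have "\<omega> (c, 0) (0, x) = - \<omega> (b, 0) (0, a *v x)"
      using \<omega>_star[of "(a, 0)" "(b, 0)" "(0, x)"] assms zero_in_M c(1)
      by (simp add: semidirect_bracket_def)
    then have "\<beta> (0, (a ** b) *v x) = - \<beta> (0, c *v x)"
      using commute[OF assms] by (simp add: \<omega>_eq matrix_vector_mul_assoc)
    then show "\<beta> (0, (c + a ** b) *v x) = 0"
      by (simp add: matrix_vector_mult_add_rdistrib \<beta>_vector_add)
  qed
  then show ?thesis using c(1) by (simp add: eq_neg_iff_add_eq_0)
qed

text \<open>Since the product preserves \<open>B\<close>, the matrix \<open>- (a ** b)\<close> is in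
  \<open>M\<close>, and \<open>M\<close> is closed under negation.\<close>

lemma matrix_mult_in_M: "a \<in> M \<Longrightarrow> b \<in> M \<Longrightarrow> a ** b \<in> M"
  using star_B_closed[of "(a, 0)" "(b, 0)"] uminus_in_M[of "- (a ** b)"]
  by (simp add: star_matrix_matrix)

text \<open>Brackets have zero matrix part, and two elements with zero matrix part are orthogonal,
  so the right side of the defining equation vanishes.\<close>

lemma star_matrix_vector: "a \<in> M \<Longrightarrow> star (a, 0) (0, x) = 0"
  and star_vector_vector: "star (0, x) (0, y) = 0"
  using zero_in_M
  by (auto intro!: star_eqI simp: zero_prod_def \<omega>_eq semidirect_bracket_def \<beta>_vector_zero)

text \<open>Paired with \<open>(d, y)\<close>, the two sides become
  \<open>- \<beta> (0, d *v (a *v x))\<close> and \<open>- \<beta> (0, a *v (d *v x))\<close>, which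
  agree by commutativity.\<close>

lemma star_vector_matrix:
  assumes "a \<in> M"
  shows "star (0, x) (a, 0) = (0, - (a *v x))"
proof (rule star_eqI)
  fix w assume "w \<in> M \<times> (UNIV :: ('k^'n) set)"
  then obtain d y where w: "w = (d, y)" "d \<in> M" by auto
  show "\<omega> (0, - (a *v x)) w = - \<omega> (a, 0) (semidirect_bracket (0, x) w)"
    using commute[OF assms w(2)]
    by (simp add: w \<omega>_eq semidirect_bracket_def matrix_vector_mul_assoc
        matrix_vector_mult_minus \<beta>_vector_minus)
qed (use assms zero_in_M in auto)

text \<open>Splitting each argument as \<open>(a, 0) + (0, x)\<close> reduces a bilinear product to
  the four prescribed kinds of values, which \<open>p\<close> and \<open>star\<close> share.\<close>

lemma star_unique:
  assumes bil: "bilinear_product_on semidirect_scale (M \<times> UNIV) p"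
    and p: "\<And>a b x y. a \<in> M \<Longrightarrow> b \<in> M \<Longrightarrow>
      p (a, 0) (b, 0) = (- (a ** b), 0) \<and> p (a, 0) (0, x) = 0 \<and>
      p (0, x) (0, y) = 0 \<and> p (0, x) (a, 0) = (0, - (a *v x))"
    and uv: "u \<in> M \<times> UNIV" "v \<in> M \<times> UNIV"
  shows "p u v = star u v"
proof -
  have expand: "q (a, x) (b, y) = q (a, 0) (b, 0) + q (a, 0) (0, y) + (q (0, x) (b, 0) + q (0, x) (0, y))"
    if "bilinear_product_on semidirect_scale (M \<times> UNIV) q" "a \<in> M" "b \<in> M" for q a b x y
  proof -
    have add: "\<And>u v w. u \<in> M \<times> UNIV \<Longrightarrow> v \<in> M \<times> UNIV \<Longrightarrow> w \<in> M \<times> UNIV \<Longrightarrow>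
        q (u + v) w = q u w + q v w \<and> q u (v + w) = q u v + q u w"
      using that(1) unfolding bilinear_product_on_def by blast
    show ?thesis
      using add[of "(a, 0)" "(0, x)" "(b, y)"] add[of "(a, 0)" "(b, 0)" "(0, y)"]
        add[of "(0, x)" "(b, 0)" "(0, y)"] that(2,3) zero_in_M by simp
  qed
  obtain a x b y where "u = (a, x)" "v = (b, y)" and M: "a \<in> M" "b \<in> M" using uv by auto
  moreover have "p (a, x) (b, y) = star (a, x) (b, y)"
    unfolding expand[OF bil M, of x y] expand[OF bilinear_star M, of x y]
    using M by (simp add: p star_matrix_matrix star_matrix_vector star_vector_vector star_vector_matrix)
  ultimately show ?thesis by simp
qed

lemma principal_element_eq: "principal_element (M \<times> UNIV) semidirect_bracket \<beta> = (- mat 1, 0)"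
proof -
  obtain c where c: "principal_element (M \<times> UNIV) semidirect_bracket \<beta> = (c, 0)" "c \<in> M"
    using principal_element_in_B by auto
  \<comment> \<open>The identity commutes with all of \<open>M\<close>, so the vanishing criterion
    applies although \<open>mat 1\<close> is not yet known to lie in \<open>M\<close>.\<close>
  have "c + mat 1 = 0"
  proof (rule commuting_matrix_eq_zero)
    fix d assume "d \<in> M"
    then show "(c + mat 1) ** d = d ** (c + mat 1)"
      using commute[OF c(2)] by (simp add: matrix_add_ldistrib matrix_add_rdistrib)
  next
    fix x
    have "\<omega> (c, 0) (0, x) = \<beta> (0, x)"
      using \<omega>_principal_element[of "(0, x)"] zero_in_M c(1) by simp
    then have "\<beta> (0, x) = - \<beta> (0, c *v x)"
      by (simp add: \<omega>_eq)
    then show "\<beta> (0, (c + mat 1) *v x) = 0"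
      by (simp add: matrix_vector_mult_add_rdistrib \<beta>_vector_add)
  qed
  then show ?thesis using c(1) by (simp add: eq_neg_iff_add_eq_0)
qed

end

theorem theorem4p1:
  fixes sc :: "'k::field_char_0 \<Rightarrow> 'g::ab_group_add \<Rightarrow> 'g"
    and G B :: "'g set"
    and br :: "'g \<Rightarrow> 'g \<Rightarrow> 'g"
    and \<alpha> :: "'g \<Rightarrow> 'k"
    and M :: "('k^'n^'n) set"
    and \<beta> :: "('k^'n^'n) \<times> ('k^'n) \<Rightarrow> 'k"
  shows
    "(two_step_frobenius sc G br B \<alpha> \<longrightarrow>
       (\<forall>a\<in>B. \<forall>b\<in>B. induced_product G br (coboundary br \<alpha>) a b \<in> B)) \<and>
     (let H = M \<times> (UNIV :: ('k^'n) set);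
          star = induced_product H semidirect_bracket (coboundary semidirect_bracket \<beta>)
      in
      module.subspace matrix_scale M \<and>
      vector_space.dim matrix_scale M = CARD('n) \<and>
      (\<forall>a\<in>M. \<forall>b\<in>M. a ** b = b ** a) \<and>
      two_step_frobenius semidirect_scale H semidirect_bracket (M \<times> {0}) \<beta> \<and>
      derived_ideal semidirect_scale H semidirect_bracket = {0} \<times> UNIV \<longrightarrow>
        (\<forall>a\<in>M. \<forall>b\<in>M. \<forall>x y.
           star (a, 0) (b, 0) = (- (a ** b), 0) \<and>
           star (a, 0) (0, x) = 0 \<and>
           star (0, x) (0, y) = 0 \<and>
           star (0, x) (a, 0) = (0, - (a *v x))) \<and>
        bilinear_product_on semidirect_scale H star \<and>
        (\<forall>p. bilinear_product_on semidirect_scale H p \<and>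
             (\<forall>a\<in>M. \<forall>b\<in>M. \<forall>x y.
                p (a, 0) (b, 0) = (- (a ** b), 0) \<and>
                p (a, 0) (0, x) = 0 \<and>
                p (0, x) (0, y) = 0 \<and>
                p (0, x) (a, 0) = (0, - (a *v x))) \<longrightarrow>
             (\<forall>u\<in>H. \<forall>v\<in>H. p u v = star u v)) \<and>
        (\<forall>a\<in>M. \<forall>b\<in>M. a ** b \<in> M) \<and>
        principal_element H semidirect_bracket \<beta> = (- mat 1, 0))"
proof (unfold Let_def, rule conjI[OF _ impI], goal_cases)
  case 1
  show ?case using two_step_frobenius.star_B_closed by blast
next
  case 2
  then interpret two_step_frobenius_matrices M \<beta>
    by (simp add: two_step_frobenius_matrices_def two_step_frobenius_matrices_axioms_def)
  show ?case
    by (intro conjI ballI allI impI; (elim conjE, rule star_unique; simp)?)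
      (simp_all add: star_matrix_matrix star_matrix_vector star_vector_vector star_vector_matrix
        bilinear_star matrix_mult_in_M principal_element_eq)
qed

end
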